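(* Let $k\ge 3$ and $n\ge k$ be integers. There does not exist any finite list $\mathcal{F}$ of $k$-sparse split sets in $\mathbb{R}^n$ such that every $k$-sparse split set in $\mathbb{R}^n$ is dominated by a single split set from $\mathcal{F}$ (that is, such that for every $k$-sparse split set $S$ in $\mathbb{R}^n$ there is a $T\in\mathcal{F}$ that dominates $S$).
   Context: For $\pi\in\mathbb{Z}^n$ and $\eta\in\mathbb{Z}$, the split set is the open set $S(\pi,\eta):=\{x\in\mathbb{R}^n \mid \eta<\pi^{\top}x<\eta+1\}$. Let $\|\pi\|_0$ denote the number of non-zero entries of $\pi$; the split set $S(\pi,\eta)$ is called $k$-sparse if $\|\pi\|_0\le k$. A split set $S(\pi^1,\eta^1)\subseteq\mathbb{R}^n$ dominates a split set $S(\pi^0,\eta^0)\subseteq\mathbb{R}^n$ if $S(\pi^1,\eta^1)\cap[0,1]^n\supseteq S(\pi^0,\eta^0)\cap[0,1]^n$. *)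

theory Defs
  imports "HOL-Analysis.Analysis"
begin

definition split_set :: "int ^ 'n \<Rightarrow> int \<Rightarrow> (real ^ 'n) set" where
  "split_set \<pi> \<eta> =
     {x. of_int \<eta> < (\<chi> i. of_int (\<pi> $ i)) \<bullet> x \<and> (\<chi> i. of_int (\<pi> $ i)) \<bullet> x < of_int \<eta> + 1}"

definition num_nonzero :: "int ^ 'n \<Rightarrow> nat" where
  "num_nonzero \<pi> = card {i. \<pi> $ i \<noteq> 0}"

text \<open>Sparsity is a property of a set: some defining pair with few non-zero entries exists.
  The vector \<open>\<pi> = 0\<close> is allowed and yields the empty split set.\<close>

definition sparse_split_set :: "nat \<Rightarrow> (real ^ 'n) set \<Rightarrow> bool" where
  "sparse_split_set k S \<longleftrightarrow> (\<exists>\<pi> \<eta>. S = split_set \<pi> \<eta> \<and> num_nonzero \<pi> \<le> k)"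

text \<open>Here \<open>1\<close> is the all-ones vector, so \<open>cbox 0 1\<close> is the unit cube.\<close>

definition dominates :: "(real ^ 'n) set \<Rightarrow> (real ^ 'n) set \<Rightarrow> bool" where
  "dominates T S \<longleftrightarrow> S \<inter> cbox 0 1 \<subseteq> T \<inter> cbox 0 1"

end

theory Submission
  imports Defs
begin

text \<open>
  The obstruction lives in three coordinates. For \<open>m \<ge> 1\<close> consider the split set
  \<open>0 < x + m y - (m + 1) z < 1\<close>. A split set that dominates it, given on these coordinates by
  \<open>\<eta> < p x + q y + r z < \<eta> + 1\<close>, has the origin in its closure, so \<open>\<eta>\<close> is \<open>0\<close> or \<open>- 1\<close>, and
  up to a sign \<open>\<eta> = 0\<close>. Evaluating its inequalities at or near four points of the polytope
  \<open>0 \<le> x + m y - (m + 1) z \<le> 1\<close> in the cube gives \<open>p > 0\<close>, \<open>q > 0\<close>,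
  \<open>(m + 1) q \<ge> m (- r)\<close>, and \<open>p + q \<le> 1 + (- r) m / (m + 1)\<close>. As \<open>p + q \<ge> 2\<close>, this forces
  \<open>r < 0\<close>. The last bound is therefore smaller than \<open>1 - r\<close>, and since \<open>p + q\<close> is an integer,
  it improves to \<open>p + q \<le> - r\<close>. Subtracting the bound for \<open>q\<close> leaves \<open>(m + 1) p \<le> - r\<close>, and
  \<open>p \<ge> 1\<close> gives \<open>\<bar>r\<bar> \<ge> m + 1\<close> (\<open>integer_slack_argument\<close>, \<open>dominating_coefficient_ge\<close>).

  Each split set of a finite list has a fixed coefficient \<open>r\<close>, so the list fails for large \<open>m\<close>.
  Restricting to the points supported on three coordinates
  (\<open>dominates_on_three_coordinates\<close>) carries this over to every dimension.
\<close>

lemma affine_nonneg_at_zero: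
  fixes u v :: real
  assumes "\<And>t. 0 < t \<Longrightarrow> t < 1 \<Longrightarrow> 0 < u + t * v"
  shows "0 \<le> u"
proof (rule tendsto_lowerbound)
  show "((\<lambda>t. u + t * v) \<longlongrightarrow> u) (at_right 0)"
    by (auto intro!: tendsto_eq_intros)
  show "\<forall>\<^sub>F t in at_right 0. 0 \<le> u + t * v"
    using assms by (auto simp: eventually_at_right_field intro!: exI[of _ 1] less_imp_le)
qed simp

text \<open>Integrality is essential: \<open>p = 1\<close>, \<open>q = m / (m + 1)\<close>, \<open>r = - 1\<close> satisfies all the
  hypotheses. Rounding the bound for \<open>p + q\<close> down to \<open>- r\<close> is what makes \<open>- r\<close> large.\<close>

lemma integer_slack_argument:
  fixes m p q r :: int
  assumes "0 < m" "0 < p" "0 < q"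
    and q: "0 \<le> (m + 1) * q + m * r"
    and sum: "(m + 1) * (p + q) + m * r \<le> m + 1"
  shows "m + 1 \<le> - r"
proof -
  have "r < 0"
  proof (rule ccontr)
    assume "\<not> r < 0"
    then have "0 \<le> m * r"
      using assms by simp
    moreover have "(m + 1) * 2 \<le> (m + 1) * (p + q)"
      using assms by (intro mult_left_mono) auto
    ultimately show False
      using sum \<open>0 < m\<close> by (simp add: algebra_simps)
  qed
  have "(m + 1) * (p + q) < (m + 1) * (1 - r)"
    using sum \<open>r < 0\<close> by (simp add: algebra_simps)
  then have "p + q < 1 - r"
    using \<open>0 < m\<close> by (simp add: mult_less_cancel_left_pos)
  then have "(m + 1) * (p + q) \<le> (m + 1) * (- r)"
    using \<open>0 < m\<close> by (intro mult_left_mono) auto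
  then have "(m + 1) * p \<le> - r"
    using q by (simp add: algebra_simps)
  moreover have "(m + 1) * 1 \<le> (m + 1) * p"
    using assms by (intro mult_left_mono) auto
  ultimately show ?thesis
    by simp
qed

lemma dominating_coefficient_ge_offset_zero:
  fixes m p q r :: int
  assumes m: "0 < m"
    and dom: "\<And>(x :: real) (y :: real) (z :: real). x \<in> {0..1} \<Longrightarrow> y \<in> {0..1} \<Longrightarrow> z \<in> {0..1} \<Longrightarrow>
      0 < x + m * y - (m + 1) * z \<Longrightarrow> x + m * y - (m + 1) * z < 1 \<Longrightarrow>
      0 < p * x + q * y + r * z \<and> p * x + q * y + r * z < 1"
  shows "m + 1 \<le> - r"
proof (rule integer_slack_argument)
  define M :: real where "M = of_int m"
  have M: "1 \<le> M"
    using m unfolding M_def by linarith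
  show "0 < m"
    by (rule m)
  show "0 < p"
    using dom[of "1/2" 0 0] by (simp add: zero_less_divide_iff)
  show "0 < q"
    using dom[of 0 "1 / (2 * M)" 0] M by (simp add: M_def zero_less_divide_iff field_simps)
  (* The next two inequalities come from points on the edges of the cube that leave the
     vertices (0, 1, 0) and (1, 1, 0) in direction z; as t tends to 0 they approach the
     boundary planes x + m y - (m + 1) z = 0 and x + m y - (m + 1) z = 1, respectively. *)
  have "0 \<le> q + r * M / (M + 1)"
  proof (rule affine_nonneg_at_zero)
    fix t :: real
    assume "0 < t" "t < 1"
    define z where "z = (M - t) / (M + 1)"
    have "(M + 1) * z = M - t" "z \<in> {0..1}"
      using M \<open>0 < t\<close> \<open>t < 1\<close> by (auto simp: z_def)
    then have "0 < q + r * z"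
      using dom[of 0 1 z] \<open>0 < t\<close> \<open>t < 1\<close> by (simp add: M_def)
    then show "0 < q + r * M / (M + 1) + t * (- r / (M + 1))"
      by (simp add: z_def add_divide_distrib diff_divide_distrib algebra_simps)
  qed
  then have "0 \<le> (M + 1) * q + M * r"
    using M by (simp add: field_simps)
  then show "0 \<le> (m + 1) * q + m * r"
    unfolding M_def by (metis (no_types) of_int_0_le_iff of_int_1 of_int_add of_int_mult)
  have "0 \<le> 1 - p - q - r * M / (M + 1)"
  proof (rule affine_nonneg_at_zero)
    fix t :: real
    assume "0 < t" "t < 1"
    define z where "z = (M + t) / (M + 1)"
    have "(M + 1) * z = M + t" "z \<in> {0..1}"
      using M \<open>0 < t\<close> \<open>t < 1\<close> by (auto simp: z_def)
    then have "p + q + r * z < 1"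
      using dom[of 1 1 z] \<open>0 < t\<close> \<open>t < 1\<close> by (simp add: M_def)
    then show "0 < 1 - p - q - r * M / (M + 1) + t * (- r / (M + 1))"
      by (simp add: z_def add_divide_distrib diff_divide_distrib algebra_simps)
  qed
  then have "(M + 1) * (p + q) + M * r \<le> M + 1"
    using M by (simp add: field_simps)
  then show "(m + 1) * (p + q) + m * r \<le> m + 1"
    unfolding M_def by (metis (no_types) of_int_le_iff of_int_1 of_int_add of_int_mult)
qed

text \<open>Only the offsets \<open>0\<close> and \<open>- 1\<close> can occur, since the dominated set accumulates at the origin;
  negating all coefficients exchanges the two.\<close>

lemma dominating_coefficient_ge:
  fixes m p q r \<eta> :: int
  assumes m: "0 < m"
    and dom: "\<And>(x :: real) (y :: real) (z :: real). x \<in> {0..1} \<Longrightarrow> y \<in> {0..1} \<Longrightarrow> z \<in> {0..1} \<Longrightarrow>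
      0 < x + m * y - (m + 1) * z \<Longrightarrow> x + m * y - (m + 1) * z < 1 \<Longrightarrow>
      \<eta> < p * x + q * y + r * z \<and> p * x + q * y + r * z < \<eta> + 1"
  shows "m + 1 \<le> \<bar>r\<bar>"
proof -
  define t :: real where "t = 1 / (2 + \<bar>of_int p\<bar>)"
  have t: "0 < t" "t < 1" "\<bar>p * t\<bar> < 1"
    by (auto simp: t_def field_simps abs_mult)
  then have "\<eta> < p * t" "p * t < \<eta> + 1"
    using dom[of t 0 0] by auto
  then have "\<eta> = 0 \<or> \<eta> = - 1"
    using t(3) by linarith
  then show ?thesis
  proof
    assume "\<eta> = 0"
    then have "m + 1 \<le> - r"
      using m dom by (intro dominating_coefficient_ge_offset_zero[of m p q]) auto
    then show ?thesis
      by simp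
  next
    assume \<eta>: "\<eta> = - 1"
    have "m + 1 \<le> - (- r)"
    proof (rule dominating_coefficient_ge_offset_zero[of m "- p" "- q"])
      fix x y z :: real
      assume "x \<in> {0..1}" "y \<in> {0..1}" "z \<in> {0..1}"
        "0 < x + m * y - (m + 1) * z" "x + m * y - (m + 1) * z < 1"
      from dom[OF this] \<eta>
      show "0 < real_of_int (- p) * x + (- q) * y + (- r) * z \<and>
            real_of_int (- p) * x + (- q) * y + (- r) * z < 1"
        by simp
    qed (rule m)
    then show ?thesis
      by simp
  qed
qed

lemma dominates_on_three_coordinates:
  fixes p \<pi> :: "int ^ 'n" and x y z :: real
  assumes dom: "dominates (split_set p \<eta>) (split_set \<pi> \<theta>)"
    and distinct: "i \<noteq> j" "i \<noteq> l" "j \<noteq> l"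
    and unit: "x \<in> {0..1}" "y \<in> {0..1}" "z \<in> {0..1}"
    and split: "\<theta> < \<pi> $ i * x + \<pi> $ j * y + \<pi> $ l * z"
      "\<pi> $ i * x + \<pi> $ j * y + \<pi> $ l * z < \<theta> + 1"
  shows "\<eta> < p $ i * x + p $ j * y + p $ l * z \<and>
    p $ i * x + p $ j * y + p $ l * z < \<eta> + 1"
proof -
  define v :: "real ^ 'n" where "v = axis i x + axis j y + axis l z"
  have inner: "(\<chi> h. real_of_int (\<rho> $ h)) \<bullet> v = \<rho> $ i * x + \<rho> $ j * y + \<rho> $ l * z"
    for \<rho> :: "int ^ 'n"
    by (simp add: v_def inner_add_right inner_axis)
  have "v \<in> cbox 0 1"
    using unit distinct by (auto simp: mem_box_cart v_def axis_def)
  moreover have "v \<in> split_set \<pi> \<theta>"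
    using split by (simp add: split_set_def inner)
  ultimately have "v \<in> split_set p \<eta>"
    using dom by (auto simp: dominates_def)
  then show ?thesis
    by (simp add: split_set_def inner)
qed

theorem theorem2:
  fixes k :: nat
  assumes "k \<ge> 3" and "CARD('n::finite) \<ge> k"
  shows "\<nexists>\<F> :: (real ^ 'n) set set.
           finite \<F> \<and> (\<forall>T\<in>\<F>. sparse_split_set k T) \<and>
           (\<forall>S. sparse_split_set k S \<longrightarrow> (\<exists>T\<in>\<F>. dominates T S))"
proof
  assume "\<exists>\<F> :: (real ^ 'n) set set.
           finite \<F> \<and> (\<forall>T\<in>\<F>. sparse_split_set k T) \<and>
           (\<forall>S. sparse_split_set k S \<longrightarrow> (\<exists>T\<in>\<F>. dominates T S))"
  then obtain \<F> :: "(real ^ 'n) set set" where fin: "finite \<F>"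
    and \<F>: "\<forall>T\<in>\<F>. sparse_split_set k T"
    and dom: "\<And>S. sparse_split_set k S \<Longrightarrow> \<exists>T\<in>\<F>. dominates T S"
    by blast
  have "3 \<le> card (UNIV :: 'n set)"
    using assms by linarith
  then obtain I :: "'n set" where "card I = 3"
    by (metis obtain_subset_with_card_n)
  then obtain i j l :: 'n where ijl: "i \<noteq> j" "i \<noteq> l" "j \<noteq> l"
    by (auto simp: card_3_iff)
  have "\<forall>T\<in>\<F>. \<exists>p \<eta>. T = split_set p \<eta>"
    using \<F> unfolding sparse_split_set_def by blast
  then obtain p \<eta> where p: "\<And>T. T \<in> \<F> \<Longrightarrow> T = split_set (p T) (\<eta> T)"
    by metis
  define m where "m = 1 + (\<Sum>T\<in>\<F>. \<bar>p T $ l\<bar>)"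
  have m_pos: "0 < m"
    unfolding m_def by (simp add: add_pos_nonneg sum_nonneg)
  have m_large: "\<bar>p T $ l\<bar> < m" if "T \<in> \<F>" for T
    using member_le_sum[of T \<F> "\<lambda>T. \<bar>p T $ l\<bar>"] that fin by (simp add: m_def)
  define \<pi> :: "int ^ 'n"
    where "\<pi> = (\<chi> h. if h = i then 1 else if h = j then m else if h = l then - (m + 1) else 0)"
  have \<pi>: "\<pi> $ i = 1" "\<pi> $ j = m" "\<pi> $ l = - (m + 1)"
    using ijl by (auto simp: \<pi>_def)
  have "num_nonzero \<pi> \<le> card {i, j, l}"
    unfolding num_nonzero_def by (rule card_mono) (auto simp: \<pi>_def)
  then have "sparse_split_set k (split_set \<pi> 0)"
    using assms ijl by (auto simp: sparse_split_set_def)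
  then obtain T where T: "T \<in> \<F>" "dominates (split_set (p T) (\<eta> T)) (split_set \<pi> 0)"
    using dom p by metis
  have "m + 1 \<le> \<bar>p T $ l\<bar>"
  proof (rule dominating_coefficient_ge[OF m_pos])
    fix x y z :: real
    assume "x \<in> {0..1}" "y \<in> {0..1}" "z \<in> {0..1}"
      "0 < x + m * y - (m + 1) * z" "x + m * y - (m + 1) * z < 1"
    then show "\<eta> T < p T $ i * x + p T $ j * y + p T $ l * z \<and>
        p T $ i * x + p T $ j * y + p T $ l * z < \<eta> T + 1"
      using dominates_on_three_coordinates[OF T(2) ijl, of x y z]
      by (simp add: \<pi> algebra_simps)
  qed
  then show False
    using m_large[OF T(1)] by simp
qed

end
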